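(* There exist a constant $c>0$ and, for each $n \ge 1$, a language $L_n$ accepted by a DFA with $O(n)$ states that is not suffix-free and such that every witness $(v,w)$ to the failure of suffix-freeness of $L_n$ satisfies $|w| \ge c n^2$; i.e. the smallest witness has size $\Omega(n^2)$.
   Context: A word $v$ is a suffix of $w$ if $w = xv$ for some word $x$. $L$ is suffix-free if no word of $L$ has a suffix different from itself that lies in $L$. A witness to the failure of suffix-freeness is a pair $(v,w)$ with $v,w \in L$, $v$ a suffix of $w$, $v \ne w$; its size is $|w|$. *)

theory Defs
  imports Complex_Main "HOL-Library.Sublist" "HOL-Library.Landau_Symbols"
begin

record ('q, 'a) dfa =
  states :: "'q set"
  alphabet :: "'a set"
  start :: 'q
  accepting :: "'q set"
  trans_fun :: "'q \<Rightarrow> 'a \<Rightarrow> 'q"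

(* Complete DFAs: the transition function is total on states and alphabet. *)
definition is_dfa :: "('q, 'a) dfa \<Rightarrow> bool" where
  "is_dfa M \<longleftrightarrow>
     finite (states M) \<and> finite (alphabet M) \<and>
     start M \<in> states M \<and> accepting M \<subseteq> states M \<and>
     (\<forall>q\<in>states M. \<forall>a\<in>alphabet M. trans_fun M q a \<in> states M)"

definition language :: "('q, 'a) dfa \<Rightarrow> 'a list set" where
  "language M = {w \<in> lists (alphabet M). foldl (trans_fun M) (start M) w \<in> accepting M}"

definition suffix_free :: "'a list set \<Rightarrow> bool" where
  "suffix_free L \<longleftrightarrow> \<not> (\<exists>w\<in>L. \<exists>v. suffix v w \<and> v \<noteq> w \<and> v \<in> L)"

definition suffix_free_witness :: "'a list set \<Rightarrow> 'a list \<times> 'a list \<Rightarrow> bool" where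
  "suffix_free_witness L = (\<lambda>(v, w). v \<in> L \<and> w \<in> L \<and> suffix v w \<and> v \<noteq> w)"

definition witness_size :: "'a list \<times> 'a list \<Rightarrow> nat" where
  "witness_size = (\<lambda>(v, w). length w)"

end

theory Submission
  imports Defs
begin

text \<open>
  The language consists of the words \<open>1 0\<^sup>i\<close> with \<open>i \<equiv> -1\<close> modulo \<open>n\<close> and the words
  \<open>2 1 0\<^sup>i\<close> with \<open>i \<equiv> -1\<close> modulo \<open>n + 1\<close>; a start part and two cycles of lengths \<open>n\<close> and \<open>n + 1\<close>
  recognise it. A word of one kind is never a proper suffix of another word of the same kind, so
  every witness is a pair \<open>(1 0\<^sup>i, 2 1 0\<^sup>i)\<close>. As \<open>n\<close> and \<open>n + 1\<close> are coprime, \<open>i + 1\<close> is then a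
  multiple of \<open>n(n + 1)\<close>.
\<close>

text \<open>
  State \<open>0\<close> is initial, state \<open>1\<close> is reached by the word \<open>2\<close>, state \<open>2\<close> is the sink. The two cycles
  occupy \<open>3, \<dots>, n + 2\<close> and \<open>n + 3, \<dots>, 2n + 3\<close>.
\<close>

definition two_cycle_step :: "nat \<Rightarrow> nat \<Rightarrow> nat \<Rightarrow> nat" where
  "two_cycle_step n q a =
     (if a = 0 then
        if q < 3 then 2
        else if q < 3 + n then 3 + Suc (q - 3) mod n
        else 3 + n + Suc (q - (3 + n)) mod Suc n
      else if a = 1 then if q = 0 then 3 else if q = 1 then 3 + n else 2
      else if q = 0 then 1 else 2)"

text \<open>The accepting states are the last ones of the two cycles, at offsets
  \<open>n - 1\<close> and \<open>n\<close>. Accepting at offset \<open>0\<close> instead would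
  admit the short witness with \<open>i = 0\<close>.\<close>

definition two_cycle_dfa :: "nat \<Rightarrow> (nat, nat) dfa" where
  "two_cycle_dfa n =
     \<lparr>states = {..<2 * n + 4}, alphabet = {0, 1, 2}, start = 0,
      accepting = {n + 2, 2 * n + 3}, trans_fun = two_cycle_step n\<rparr>"

lemma is_dfa_two_cycle:
  assumes "n \<ge> 1"
  shows "is_dfa (two_cycle_dfa n)"
proof -
  have "two_cycle_step n q a < 2 * n + 4" for q a
  proof -
    have "Suc (q - 3) mod n < n" "Suc (q - (3 + n)) mod Suc n < Suc n"
      using assms by (auto intro: mod_less_divisor)
    then show ?thesis
      unfolding two_cycle_step_def by (simp del: mod_less_divisor)
  qed
  then show ?thesis
    by (simp add: is_dfa_def two_cycle_dfa_def)
qed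

lemma two_cycle_run_sink: "foldl (two_cycle_step n) 2 u = 2"
  by (induction u) (auto simp: two_cycle_step_def)

text \<open>On a cycle the letter \<open>0\<close> advances the offset by one, and any other letter
  leads to the sink for good. The start offset \<open>r\<close> is arbitrary so that the induction
  on \<open>u\<close> goes through.\<close>

lemma two_cycle_run_first:
  assumes "r < n"
  shows "foldl (two_cycle_step n) (3 + r) u =
    (if set u \<subseteq> {0} then 3 + (r + length u) mod n else 2)"
  using assms
proof (induction u arbitrary: r)
  case Nil
  then show ?case by simp
next
  case (Cons a u)
  show ?case
  proof (cases "a = 0")
    case True
    have "two_cycle_step n (3 + r) a = 3 + Suc r mod n"
      using True Cons.prems by (simp add: two_cycle_step_def)
    moreover have "Suc r mod n < n"
      using Cons.prems by simp
    ultimately show ?thesis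
      using True Cons.IH[of "Suc r mod n"] by (simp add: mod_add_left_eq)
  next
    case False
    then have "two_cycle_step n (3 + r) a = 2"
      by (simp add: two_cycle_step_def)
    then show ?thesis
      using False by (simp add: two_cycle_run_sink)
  qed
qed

lemma two_cycle_run_second:
  assumes "r < Suc n"
  shows "foldl (two_cycle_step n) (3 + n + r) u =
    (if set u \<subseteq> {0} then 3 + n + (r + length u) mod Suc n else 2)"
  using assms
proof (induction u arbitrary: r)
  case Nil
  then show ?case by simp
next
  case (Cons a u)
  show ?case
  proof (cases "a = 0")
    case True
    have "two_cycle_step n (3 + n + r) a = 3 + n + Suc r mod Suc n"
      using True by (simp add: two_cycle_step_def)
    moreover have "Suc r mod Suc n < Suc n"
      by (rule mod_less_divisor) simp
    moreover have "(Suc r mod Suc n + length u) mod Suc n = (r + length (a # u)) mod Suc n"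
      by (simp add: mod_add_left_eq)
    ultimately show ?thesis
      using True Cons.IH[of "Suc r mod Suc n"] by simp
  next
    case False
    then have "two_cycle_step n (3 + n + r) a = 2"
      by (simp add: two_cycle_step_def)
    then show ?thesis
      using False by (simp add: two_cycle_run_sink)
  qed
qed

text \<open>Turns standing at the last state of a cycle into divisibility: one more step would
  return to offset \<open>0\<close>.\<close>

lemma mod_eq_pred_iff_dvd_Suc:
  fixes k n :: nat
  assumes "n \<ge> 1"
  shows "Suc (k mod n) = n \<longleftrightarrow> n dvd Suc k"
  using assms by (auto simp: dvd_eq_mod_eq_0 mod_Suc split: if_splits)

lemma accepted_from_first_cycle:
  assumes "n \<ge> 1"
  shows "foldl (two_cycle_step n) 3 u \<in> {n + 2, 2 * n + 3} \<longleftrightarrow>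
    (\<exists>i. u = replicate i 0 \<and> n dvd Suc i)"
proof -
  \<comment> \<open>The bound keeps the run below \<open>n + 3\<close>, so the accepting state
    \<open>2 * n + 3\<close> of the other cycle is out of reach.\<close>
  have "length u mod n < n"
    using assms by simp
  then have "foldl (two_cycle_step n) 3 u \<in> {n + 2, 2 * n + 3} \<longleftrightarrow>
      set u \<subseteq> {0} \<and> Suc (length u mod n) = n"
    using assms two_cycle_run_first[of 0 n u] by (auto simp del: mod_less_divisor)
  also have "\<dots> \<longleftrightarrow> set u \<subseteq> {0} \<and> n dvd Suc (length u)"
    by (simp add: mod_eq_pred_iff_dvd_Suc[OF assms])
  also have "\<dots> \<longleftrightarrow> (\<exists>i. u = replicate i 0 \<and> n dvd Suc i)"
    using replicate_length_same[of u 0] by (auto simp: subset_iff) metis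
  finally show ?thesis .
qed

lemma accepted_from_second_cycle:
  assumes "n \<ge> 1"
  shows "foldl (two_cycle_step n) (3 + n) u \<in> {n + 2, 2 * n + 3} \<longleftrightarrow>
    (\<exists>i. u = replicate i 0 \<and> Suc n dvd Suc i)"
proof -
  have "foldl (two_cycle_step n) (3 + n) u \<in> {n + 2, 2 * n + 3} \<longleftrightarrow>
      set u \<subseteq> {0} \<and> Suc (length u mod Suc n) = Suc n"
    using assms two_cycle_run_second[of 0 n u] by auto
  also have "\<dots> \<longleftrightarrow> set u \<subseteq> {0} \<and> Suc n dvd Suc (length u)"
    by (subst mod_eq_pred_iff_dvd_Suc) simp_all
  also have "\<dots> \<longleftrightarrow> (\<exists>i. u = replicate i 0 \<and> Suc n dvd Suc i)"
    using replicate_length_same[of u 0] by (auto simp: subset_iff) metis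
  finally show ?thesis .
qed

text \<open>The opening letters decide: \<open>1\<close> enters the first cycle and
  \<open>2\<close>, \<open>1\<close> the second. Any other word stops in state \<open>0\<close> or
  \<open>1\<close> or falls into the sink, and none of these accepts.\<close>

lemma language_two_cycle:
  assumes "n \<ge> 1"
  shows "language (two_cycle_dfa n) =
    {1 # replicate i 0 | i. n dvd Suc i} \<union> {2 # 1 # replicate i 0 | i. Suc n dvd Suc i}"
    (is "_ = ?A \<union> ?B")
proof (intro set_eqI iffI)
  fix w
  assume "w \<in> language (two_cycle_dfa n)"
  then have letters: "set w \<subseteq> {0, 1, 2}"
    and acc: "foldl (two_cycle_step n) 0 w \<in> {n + 2, 2 * n + 3}"
    by (auto simp: language_def two_cycle_dfa_def)
  have sink: "2 \<notin> {n + 2, 2 * n + 3}"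
    using assms by auto
  obtain a u where w: "w = a # u"
    using acc by (cases w) auto
  consider "a = 0" | "a = 1" | "a = 2"
    using letters w by auto
  then show "w \<in> ?A \<union> ?B"
  proof cases
    case 1
    then show ?thesis
      using acc sink w by (simp add: two_cycle_step_def two_cycle_run_sink)
  next
    case 2
    then have "foldl (two_cycle_step n) 3 u \<in> {n + 2, 2 * n + 3}"
      using acc w by (simp add: two_cycle_step_def)
    then show ?thesis
      using 2 w unfolding accepted_from_first_cycle[OF assms] by auto
  next
    case 3
    then have acc1: "foldl (two_cycle_step n) 1 u \<in> {n + 2, 2 * n + 3}"
      using acc w by (simp add: two_cycle_step_def)
    then obtain b t where u: "u = b # t"
      using assms by (cases u) auto
    have "b = 1"
    proof (rule ccontr)
      assume "b \<noteq> 1"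
      then have "two_cycle_step n 1 b = 2"
        by (simp add: two_cycle_step_def)
      then show False
        using acc1 sink u by (simp add: two_cycle_run_sink)
    qed
    then have "foldl (two_cycle_step n) (3 + n) t \<in> {n + 2, 2 * n + 3}"
      using acc1 u by (simp add: two_cycle_step_def)
    then show ?thesis
      using 3 w u \<open>b = 1\<close> unfolding accepted_from_second_cycle[OF assms] by auto
  qed
next
  fix w
  assume "w \<in> ?A \<union> ?B"
  then consider i where "w = 1 # replicate i 0" "n dvd Suc i"
    | i where "w = 2 # 1 # replicate i 0" "Suc n dvd Suc i"
    by auto
  then show "w \<in> language (two_cycle_dfa n)"
  proof cases
    case 1
    then have "foldl (two_cycle_step n) 3 (replicate i 0) \<in> {n + 2, 2 * n + 3}"
      unfolding accepted_from_first_cycle[OF assms] by auto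
    then show ?thesis
      using 1 by (auto simp: language_def two_cycle_dfa_def two_cycle_step_def)
  next
    case 2
    then have "foldl (two_cycle_step n) (3 + n) (replicate i 0) \<in> {n + 2, 2 * n + 3}"
      unfolding accepted_from_second_cycle[OF assms] by auto
    then show ?thesis
      using 2 by (auto simp: language_def two_cycle_dfa_def two_cycle_step_def)
  qed
qed

text \<open>The only proper suffix of a word of the language that starts with a nonzero letter
  arises by deleting a leading \<open>2\<close>. Hence both words share the same \<open>i\<close>,
  which must satisfy both divisibilities.\<close>

lemma suffix_free_witness_two_cycle_iff:
  assumes "n \<ge> 1"
  shows "suffix_free_witness (language (two_cycle_dfa n)) (v, w) \<longleftrightarrow>
    (\<exists>i. v = 1 # replicate i 0 \<and> w = 2 # 1 # replicate i 0 \<and> n * Suc n dvd Suc i)"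
proof -
  \<comment> \<open>Coprimality of consecutive numbers enters here, through
    \<open>divides_mult\<close>.\<close>
  have "n * Suc n dvd k \<longleftrightarrow> n dvd k \<and> Suc n dvd k" for k
    using divides_mult[of n k "Suc n"]
    by (auto dest: dvd_mult_left dvd_mult_right simp del: mult_Suc_right)
  moreover have "\<not> suffix (a # xs) (replicate j 0)" if "a \<noteq> 0" for a :: nat and xs j
  proof
    assume "suffix (a # xs) (replicate j 0)"
    then have "a \<in> set (replicate j 0)"
      by (meson list.set_intros(1) set_mono_suffix subsetD)
    then show False
      using that by simp
  qed
  ultimately show ?thesis
    unfolding suffix_free_witness_def language_two_cycle[OF assms]
    by (auto simp: suffix_Cons simp del: mult_Suc_right)
qed

theorem theorem14:
  "\<exists>(c::real) > 0. \<exists>(\<Sigma> :: nat set) (L :: nat \<Rightarrow> nat list set) (M :: nat \<Rightarrow> (nat, nat) dfa).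
     (\<forall>n\<ge>1. is_dfa (M n) \<and> alphabet (M n) = \<Sigma> \<and> language (M n) = L n) \<and>
     (\<lambda>n. real (card (states (M n)))) \<in> O(\<lambda>n. real n) \<and>
     (\<forall>n\<ge>1. \<not> suffix_free (L n) \<and>
        (\<forall>v w. suffix_free_witness (L n) (v, w) \<longrightarrow>
           real (witness_size (v, w)) \<ge> c * (real n)\<^sup>2))"
proof (intro exI[of _ "1::real"] exI[of _ "{0, 1, 2}"]
    exI[of _ "\<lambda>n. language (two_cycle_dfa n)"] exI[of _ two_cycle_dfa] conjI allI impI)
  \<comment> \<open>For \<open>n \<ge> 1\<close> the number of states is
    \<open>2 * n + 4 \<le> 6 * n\<close>.\<close>
  show "(\<lambda>n. real (card (states (two_cycle_dfa n)))) \<in> O(\<lambda>n. real n)"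
    by (rule bigoI[of _ 6], rule eventually_mono[OF eventually_ge_at_top[of 1]])
      (simp add: two_cycle_dfa_def)
next
  fix n :: nat
  assume n: "1 \<le> n"
  \<comment> \<open>The least admissible exponent; as \<open>n \<ge> 1\<close>, its successor is
    exactly \<open>n * Suc n\<close>.\<close>
  let ?i = "n * Suc n - 1"
  have "suffix_free_witness (language (two_cycle_dfa n))
      (1 # replicate ?i 0, 2 # 1 # replicate ?i 0)"
    unfolding suffix_free_witness_two_cycle_iff[OF n] using n by auto
  then show "\<not> suffix_free (language (two_cycle_dfa n))"
    unfolding suffix_free_def suffix_free_witness_def by blast
next
  fix n :: nat and v w
  assume n: "1 \<le> n" and "suffix_free_witness (language (two_cycle_dfa n)) (v, w)"
  then obtain i where w: "w = 2 # 1 # replicate i 0" and "n * Suc n dvd Suc i"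
    unfolding suffix_free_witness_two_cycle_iff[OF n] by auto
  then have "n * Suc n \<le> Suc i"
    by (intro dvd_imp_le) auto
  \<comment> \<open>The length is \<open>i + 2\<close>, which exceeds \<open>n * Suc n\<close>;
    hence the constant \<open>1\<close> suffices.\<close>
  then have "n\<^sup>2 \<le> length w"
    using w by (simp add: power2_eq_square)
  then show "1 * (real n)\<^sup>2 \<le> real (witness_size (v, w))"
    unfolding witness_size_def by (simp flip: of_nat_power)
qed (simp_all add: is_dfa_two_cycle, simp add: two_cycle_dfa_def)

end
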